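(* Consider the discrete Hashin--Shtrikman problem $$\min_{\{c_j\},\{\mathbf E_i\},\{v_i^+\}}\sum_{j=1}^{n_{lc}}c_j\ \text{ s.t. }\begin{pmatrix}c_j&-f_j^T\\-f_j&K_j(\{\mathbf E_i\})\end{pmatrix}\succeq0\ \forall j,\quad\mathbf E_i\in\mathcal A^{(2)}(v_i^+)\ \forall i,\quad\frac1{n_e}\sum_{i=1}^{n_e}v_i^+\le\overline V,\quad0\le v_i^+\le1\ \forall i.$$ There exists an optimal solution of this problem such that, for every element $i$, $$v_i^+=\overline v_i(\mathbf E_i)=\inf\{v\in[0,1]:\mathbf E_i\in\mathcal A^{(2)}(v)\},$$ where $\overline v_i(\mathbf E_i):=\sup\{\hat v(\varepsilon;\mathbf E_i):\varepsilon\in\mathbb S^{2\times2},\ \|\varepsilon\|_F=\sqrt2/2\}$ and $\hat v(\varepsilon;\mathbf E_i)$ is the smallest $v\in[0,1]$ with $\langle\mathbf E_i\varepsilon,\varepsilon\rangle\le f^{HS}(\varepsilon;v)$.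
   Context: $\mathbb S^{2\times2}$ is the space of real symmetric $2\times2$ matrices with the Frobenius inner product; $\mathbb S^{2\times2\times2\times2}$ is the space of fourth-order tensors acting as self-adjoint linear maps on $\mathbb S^{2\times2}$; $\preceq$ is the Loewner order. $\mathbf E^\pm\varepsilon=\kappa^\pm\mathrm{Tr}(\varepsilon)I+2\mu^\pm(\varepsilon-\tfrac12\mathrm{Tr}(\varepsilon)I)$ with $0<\kappa^-<\kappa^+$, $0<\mu^-<\mu^+$; $\Delta\kappa=\kappa^+-\kappa^-$, $\Delta\mu=\mu^+-\mu^-$. $\overline V\in[0,1]$. $\mathcal A^{(2)}(v)=\{\mathbf E:\mathbf E^-\preceq\mathbf E,\ \langle\mathbf E\varepsilon,\varepsilon\rangle\le f^{HS}(\varepsilon;v)\ \forall\varepsilon\in\mathbb S^{2\times2}\}$, where $f^{HS}(\varepsilon;v)=\langle[(1-v)\mathbf E^-+v\mathbf E^+]\varepsilon,\varepsilon\rangle-q(\varepsilon;v)$ and, with $t=|\mathrm{Tr}(\varepsilon)|$, $s=\sqrt{\mathrm{Tr}(\varepsilon)^2-4\det\varepsilon}$, $q=\dfrac{v(1-v)(\Delta\kappa\,t-\Delta\mu\,s)^2}{\kappa^++\mu^+-(\Delta\kappa+\Delta\mu)v}$ if $v t\Delta\kappa\le(\kappa^++\mu^+-\Delta\kappa v)s$ and $v s\Delta\mu\le(\kappa^++\mu^+-\Delta\mu v)t$; $q=(1-v)\Big[\dfrac{v t^2\Delta\kappa^2}{\kappa^++\mu^+-\Delta\kappa v}-s^2\Delta\mu\Big]$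 if $v t\Delta\kappa>(\kappa^++\mu^+-\Delta\kappa v)s$; $q=(1-v)\Big[\dfrac{v s^2\Delta\mu^2}{\kappa^++\mu^+-\Delta\mu v}-t^2\Delta\kappa\Big]$ if $v s\Delta\mu>(\kappa^++\mu^+-\Delta\mu v)t$. Finite-element setting: $n_e\ge1$ equisized elements, $n_{lc}\ge1$ loadcases, load vectors $f_j\in\mathbb R^{n_j}$, assembled stiffness matrices $K_j(\{\mathbf E_i\})$, symmetric, linear in $(\mathbf E_1,\dots,\mathbf E_{n_e})$, positive semidefinite if all $\mathbf E_i\succeq0$ and positive definite if all $\mathbf E_i\succ0$. *)

theory Defs
  imports "HOL-Analysis.Analysis" "Jordan_Normal_Form.Matrix"
begin

(* From here on, $ and the bullet are those of HOL-Analysis, used for 2x2 matrices and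
   tensors; on real^2^2 the inner product and the norm are the Frobenius ones.  The stiffness
   matrices, whose size depends on the loadcase, are real mat of Jordan_Normal_Form. *)
no_notation vec_index (infixl "$" 100)
no_notation scalar_prod (infix "\<bullet>" 70)

definition sym2 :: "(real^2^2) set" where
  "sym2 = {\<epsilon>. transpose \<epsilon> = \<epsilon>}"

type_synonym tensor4 = "real^2^2^2^2"

definition tensor_app :: "tensor4 \<Rightarrow> real^2^2 \<Rightarrow> real^2^2" where
  "tensor_app E \<epsilon> = (\<chi> i j. \<Sum>k\<in>UNIV. \<Sum>l\<in>UNIV. E $ i $ j $ k $ l * \<epsilon> $ k $ l)"

(* Minor and major symmetries.  By sym4_app and sym4_represents, the tensors in sym4
   correspond one-to-one to the self-adjoint linear maps on sym2. *)
definition sym4 :: "tensor4 set" where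
  "sym4 = {E. \<forall>i j k l. E $ i $ j $ k $ l = E $ j $ i $ k $ l
                      \<and> E $ i $ j $ k $ l = E $ i $ j $ l $ k
                      \<and> E $ i $ j $ k $ l = E $ k $ l $ i $ j}"

lemma matrix2_eq_iff:
  fixes A B :: "real^2^2"
  shows "A = B \<longleftrightarrow> A$1$1 = B$1$1 \<and> A$1$2 = B$1$2 \<and> A$2$1 = B$2$1 \<and> A$2$2 = B$2$2"
  by (auto simp: Finite_Cartesian_Product.vec_eq_iff forall_2)

lemma mem_sym2: "\<epsilon> \<in> sym2 \<longleftrightarrow> \<epsilon>$1$2 = \<epsilon>$2$1"
  by (auto simp: sym2_def matrix2_eq_iff Finite_Cartesian_Product.transpose_def)

lemma sym4D:
  assumes "E \<in> sym4"
  shows "E $ i $ j $ k $ l = E $ j $ i $ k $ l"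
    and "E $ i $ j $ k $ l = E $ i $ j $ l $ k"
    and "E $ i $ j $ k $ l = E $ k $ l $ i $ j"
  using assms unfolding sym4_def by blast+

lemma sym4_app:
  assumes "E \<in> sym4"
  shows "tensor_app E \<epsilon> \<in> sym2"
    and "tensor_app E \<epsilon> \<bullet> \<eta> = \<epsilon> \<bullet> tensor_app E \<eta>"
proof -
  show "tensor_app E \<epsilon> \<in> sym2"
    unfolding mem_sym2 tensor_app_def by (simp add: sym4D(1)[OF assms, of 1 2])
  note major = sym4D(3)[OF assms]
  show "tensor_app E \<epsilon> \<bullet> \<eta> = \<epsilon> \<bullet> tensor_app E \<eta>"
    unfolding tensor_app_def inner_vec_def
    by (simp add: sum_2 major[of 1 2 1 1] major[of 2 1 1 1] major[of 2 2 1 1]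
        major[of 2 1 1 2] major[of 2 2 1 2] major[of 2 2 2 1])
      (simp only: algebra_simps)
qed

lemma sym4_represents:
  fixes L :: "real^2^2 \<Rightarrow> real^2^2"
  assumes ran: "\<And>\<epsilon>. \<epsilon> \<in> sym2 \<Longrightarrow> L \<epsilon> \<in> sym2"
    and add: "\<And>\<epsilon> \<eta>. \<epsilon> \<in> sym2 \<Longrightarrow> \<eta> \<in> sym2 \<Longrightarrow> L (\<epsilon> + \<eta>) = L \<epsilon> + L \<eta>"
    and scale: "\<And>a \<epsilon>. \<epsilon> \<in> sym2 \<Longrightarrow> L (a *\<^sub>R \<epsilon>) = a *\<^sub>R L \<epsilon>"
    and adj: "\<And>\<epsilon> \<eta>. \<epsilon> \<in> sym2 \<Longrightarrow> \<eta> \<in> sym2 \<Longrightarrow> L \<epsilon> \<bullet> \<eta> = \<epsilon> \<bullet> L \<eta>"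
  shows "\<exists>!E. E \<in> sym4 \<and> (\<forall>\<epsilon>\<in>sym2. tensor_app E \<epsilon> = L \<epsilon>)"
proof -
  define S :: "2 \<Rightarrow> 2 \<Rightarrow> real^2^2" where
    "S k l = (\<chi> i j. ((if i = k \<and> j = l then 1 else 0) + (if i = l \<and> j = k then 1 else 0)) / 2)"
    for k l
  define E :: tensor4 where "E = (\<chi> i j k l. L (S k l) \<bullet> S i j)"
  have S_sym: "S k l \<in> sym2" for k l
    by (auto simp: mem_sym2 S_def)
  have S_swap: "S k l = S l k" for k l
    by (simp only: S_def add.commute)
  have S_inner: "A \<bullet> S i j = A $ i $ j" if "A \<in> sym2" for A i j
  proof -
    have "A \<bullet> S i j = (A $ i $ j + A $ j $ i) / 2"
      using exhaust_2[of i] exhaust_2[of j]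
      by (elim disjE) (simp_all add: S_def inner_vec_def sum_2)
    moreover have "A $ j $ i = A $ i $ j"
      using exhaust_2[of i] exhaust_2[of j] that unfolding mem_sym2
      by (elim disjE) simp_all
    ultimately show ?thesis by simp
  qed
  have E_nth: "E $ i $ j $ k $ l = L (S k l) $ i $ j" for i j k l
    by (simp add: E_def S_inner ran S_sym)
  have "E $ i $ j $ k $ l = E $ j $ i $ k $ l" "E $ i $ j $ k $ l = E $ i $ j $ l $ k" for i j k l
    using S_swap[of i j] S_swap[of k l] by (simp_all add: E_def)
  moreover have "E $ i $ j $ k $ l = E $ k $ l $ i $ j" for i j k l
    using adj[OF S_sym S_sym, of k l i j] by (simp add: E_def inner_commute)
  ultimately have E4: "E \<in> sym4"
    unfolding sym4_def by blast
  have dec: "\<epsilon> = \<epsilon>$1$1 *\<^sub>R S 1 1 + ((2 * \<epsilon>$1$2) *\<^sub>R S 1 2 + \<epsilon>$2$2 *\<^sub>R S 2 2)" if "\<epsilon> \<in> sym2" for \<epsilon>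
    using that by (simp add: mem_sym2 matrix2_eq_iff S_def)
  have sc: "a *\<^sub>R S k l \<in> sym2" for a k l
    using S_sym[of k l] by (simp add: mem_sym2)
  have sadd: "A + B \<in> sym2" if "A \<in> sym2" "B \<in> sym2" for A B
    using that by (simp add: mem_sym2)
  have E_app: "tensor_app E \<epsilon> = L \<epsilon>" if \<epsilon>: "\<epsilon> \<in> sym2" for \<epsilon>
  proof -
    have "L \<epsilon> = L (\<epsilon>$1$1 *\<^sub>R S 1 1 + ((2 * \<epsilon>$1$2) *\<^sub>R S 1 2 + \<epsilon>$2$2 *\<^sub>R S 2 2))"
      using dec[OF \<epsilon>] by simp
    also have "\<dots> = \<epsilon>$1$1 *\<^sub>R L (S 1 1) + ((2 * \<epsilon>$1$2) *\<^sub>R L (S 1 2) + \<epsilon>$2$2 *\<^sub>R L (S 2 2))"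
      by (simp add: add scale sc sadd S_sym)
    also have "\<dots> = tensor_app E \<epsilon>"
      using \<epsilon> unfolding mem_sym2
      by (simp add: tensor_app_def sum_2 Finite_Cartesian_Product.vec_eq_iff E_nth S_swap[of 2 1])
    finally show ?thesis by simp
  qed
  have app_S: "tensor_app F (S k l) $ i $ j = F $ i $ j $ k $ l" if "F \<in> sym4" for F i j k l
  proof -
    have "F $ i $ j $ 1 $ 2 = F $ i $ j $ 2 $ 1"
      by (rule sym4D(2)[OF that])
    then show ?thesis
      using exhaust_2[of k] exhaust_2[of l]
      by (elim disjE) (simp_all add: tensor_app_def S_def sum_2)
  qed
  have uniq: "F = E" if "F \<in> sym4" "\<forall>\<epsilon>\<in>sym2. tensor_app F \<epsilon> = L \<epsilon>" for F
  proof -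
    have "F $ i $ j $ k $ l = E $ i $ j $ k $ l" for i j k l
    proof -
      have "F $ i $ j $ k $ l = tensor_app F (S k l) $ i $ j"
        by (rule app_S[OF that(1), symmetric])
      also have "\<dots> = E $ i $ j $ k $ l"
        using that(2) S_sym E_nth by metis
      finally show ?thesis .
    qed
    then show ?thesis by (simp add: Finite_Cartesian_Product.vec_eq_iff)
  qed
  show ?thesis
    using E4 E_app uniq by blast
qed

definition loewner_le :: "tensor4 \<Rightarrow> tensor4 \<Rightarrow> bool" where
  "loewner_le E F \<longleftrightarrow> (\<forall>\<epsilon>\<in>sym2. 0 \<le> tensor_app (F - E) \<epsilon> \<bullet> \<epsilon>)"

definition loewner_less :: "tensor4 \<Rightarrow> tensor4 \<Rightarrow> bool" where
  "loewner_less E F \<longleftrightarrow> (\<forall>\<epsilon>\<in>sym2. \<epsilon> \<noteq> 0 \<longrightarrow> 0 < tensor_app (F - E) \<epsilon> \<bullet> \<epsilon>)"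

(* Isotropic tensor with bulk modulus \<kappa> and shear modulus \<mu>; see iso_tensor_app for its action. *)
definition iso_tensor :: "real \<Rightarrow> real \<Rightarrow> tensor4" where
  "iso_tensor \<kappa> \<mu> = (\<chi> i j k l.
     (\<kappa> - \<mu>) * (if i = j \<and> k = l then 1 else 0)
     + \<mu> * ((if i = k \<and> j = l then 1 else 0) + (if i = l \<and> j = k then 1 else 0)))"

lemma iso_tensor_sym4: "iso_tensor \<kappa> \<mu> \<in> sym4"
  by (auto simp: sym4_def iso_tensor_def)

lemma iso_tensor_app:
  assumes "\<epsilon> \<in> sym2"
  shows "tensor_app (iso_tensor \<kappa> \<mu>) \<epsilon> =
    (\<kappa> * trace \<epsilon>) *\<^sub>R Finite_Cartesian_Product.mat 1
    + (2 * \<mu>) *\<^sub>R (\<epsilon> - (trace \<epsilon> / 2) *\<^sub>R Finite_Cartesian_Product.mat 1)"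
proof -
  have sym: "\<epsilon> $ 2 $ 1 = \<epsilon> $ 1 $ 2" using assms by (simp add: mem_sym2)
  show ?thesis
    unfolding matrix2_eq_iff tensor_app_def iso_tensor_def trace_def sum_2
      Finite_Cartesian_Product.mat_def
    by (simp add: sym) (simp add: field_simps)
qed

(* For v in [0,1] the second and third regimes exclude each other, so the order of the
   case distinction is immaterial. *)
definition hs_q :: "real \<Rightarrow> real \<Rightarrow> real \<Rightarrow> real \<Rightarrow> real^2^2 \<Rightarrow> real \<Rightarrow> real" where
  "hs_q \<kappa>m \<kappa>p \<mu>m \<mu>p \<epsilon> v =
    (let t = \<bar>trace \<epsilon>\<bar>; s = sqrt ((trace \<epsilon>)\<^sup>2 - 4 * det \<epsilon>);
         \<Delta>\<kappa> = \<kappa>p - \<kappa>m; \<Delta>\<mu> = \<mu>p - \<mu>m in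
     if v * t * \<Delta>\<kappa> \<le> (\<kappa>p + \<mu>p - \<Delta>\<kappa> * v) * s \<and> v * s * \<Delta>\<mu> \<le> (\<kappa>p + \<mu>p - \<Delta>\<mu> * v) * t
     then v * (1 - v) * (\<Delta>\<kappa> * t - \<Delta>\<mu> * s)\<^sup>2 / (\<kappa>p + \<mu>p - (\<Delta>\<kappa> + \<Delta>\<mu>) * v)
     else if v * t * \<Delta>\<kappa> > (\<kappa>p + \<mu>p - \<Delta>\<kappa> * v) * s
     then (1 - v) * (v * t\<^sup>2 * \<Delta>\<kappa>\<^sup>2 / (\<kappa>p + \<mu>p - \<Delta>\<kappa> * v) - s\<^sup>2 * \<Delta>\<mu>)
     else (1 - v) * (v * s\<^sup>2 * \<Delta>\<mu>\<^sup>2 / (\<kappa>p + \<mu>p - \<Delta>\<mu> * v) - t\<^sup>2 * \<Delta>\<kappa>))"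

definition f_HS :: "real \<Rightarrow> real \<Rightarrow> real \<Rightarrow> real \<Rightarrow> real^2^2 \<Rightarrow> real \<Rightarrow> real" where
  "f_HS \<kappa>m \<kappa>p \<mu>m \<mu>p \<epsilon> v =
     tensor_app ((1 - v) *\<^sub>R iso_tensor \<kappa>m \<mu>m + v *\<^sub>R iso_tensor \<kappa>p \<mu>p) \<epsilon> \<bullet> \<epsilon>
     - hs_q \<kappa>m \<kappa>p \<mu>m \<mu>p \<epsilon> v"

definition A2 :: "real \<Rightarrow> real \<Rightarrow> real \<Rightarrow> real \<Rightarrow> real \<Rightarrow> tensor4 set" where
  "A2 \<kappa>m \<kappa>p \<mu>m \<mu>p v =
     {E \<in> sym4. loewner_le (iso_tensor \<kappa>m \<mu>m) E
        \<and> (\<forall>\<epsilon>\<in>sym2. tensor_app E \<epsilon> \<bullet> \<epsilon> \<le> f_HS \<kappa>m \<kappa>p \<mu>m \<mu>p \<epsilon> v)}"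

(* The minimum exists whenever E lies in A2 \<kappa>m \<kappa>p \<mu>m \<mu>p w for some w in [0,1], because
   f_HS is continuous in v there; otherwise the value of LEAST is irrelevant. *)
definition v_hat :: "real \<Rightarrow> real \<Rightarrow> real \<Rightarrow> real \<Rightarrow> real^2^2 \<Rightarrow> tensor4 \<Rightarrow> real" where
  "v_hat \<kappa>m \<kappa>p \<mu>m \<mu>p \<epsilon> E =
     (LEAST v. v \<in> {0..1} \<and> tensor_app E \<epsilon> \<bullet> \<epsilon> \<le> f_HS \<kappa>m \<kappa>p \<mu>m \<mu>p \<epsilon> v)"

definition v_bar :: "real \<Rightarrow> real \<Rightarrow> real \<Rightarrow> real \<Rightarrow> tensor4 \<Rightarrow> real" where
  "v_bar \<kappa>m \<kappa>p \<mu>m \<mu>p E =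
     Sup {v_hat \<kappa>m \<kappa>p \<mu>m \<mu>p \<epsilon> E | \<epsilon>. \<epsilon> \<in> sym2 \<and> norm \<epsilon> = sqrt 2 / 2}"

definition mat_psd :: "real mat \<Rightarrow> bool" where
  "mat_psd A \<longleftrightarrow> transpose_mat A = A
     \<and> (\<forall>x\<in>carrier_vec (dim_row A). 0 \<le> scalar_prod x (A *\<^sub>v x))"

definition mat_pd :: "real mat \<Rightarrow> bool" where
  "mat_pd A \<longleftrightarrow> transpose_mat A = A
     \<and> (\<forall>x\<in>carrier_vec (dim_row A). x \<noteq> 0\<^sub>v (dim_row A) \<longrightarrow> 0 < scalar_prod x (A *\<^sub>v x))"

definition compliance_mat :: "real \<Rightarrow> real Matrix.vec \<Rightarrow> real mat \<Rightarrow> real mat" where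
  "compliance_mat c f K =
     four_block_mat (Matrix.mat 1 1 (\<lambda>_. c)) (mat_of_row (- f))
                    (transpose_mat (mat_of_row (- f))) K"

(* Feasible triples (c, E, v) of the discrete Hashin-Shtrikman problem; 'l indexes the
   loadcases and 'e the elements. *)
definition hs_feasible ::
  "real \<Rightarrow> real \<Rightarrow> real \<Rightarrow> real \<Rightarrow> ('l::finite \<Rightarrow> real Matrix.vec)
   \<Rightarrow> ('l \<Rightarrow> ('e::finite \<Rightarrow> tensor4) \<Rightarrow> real mat) \<Rightarrow> real
   \<Rightarrow> (('l \<Rightarrow> real) \<times> ('e \<Rightarrow> tensor4) \<times> ('e \<Rightarrow> real)) set" where
  "hs_feasible \<kappa>m \<kappa>p \<mu>m \<mu>p f K V =
     {(c, E, v). (\<forall>j. mat_psd (compliance_mat (c j) (f j) (K j E)))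
        \<and> (\<forall>i. E i \<in> A2 \<kappa>m \<kappa>p \<mu>m \<mu>p (v i))
        \<and> (\<Sum>i\<in>UNIV. v i) / real CARD('e) \<le> V
        \<and> (\<forall>i. 0 \<le> v i \<and> v i \<le> 1)}"

end

theory Submission
  imports Defs "Jordan_Normal_Form.Determinant"
begin

text \<open>
  For fixed strain the Hashin--Shtrikman bound is continuous and nondecreasing in the volume
  fraction v: in each regime it is an affine function of v minus D v (1 - v) / (A - B v), which has
  slope at most D / A, and in v the regimes change at most once, with matching values. It is moreover
  homogeneous of degree two in the strain. Hence the volume fractions admissible for a given tensor
  form an interval [v_bar, 1]. Every admissible tensor lies between the two phases, so the feasible
  points of bounded compliance form a compact set, which is nonempty because the weak phase with
  v = 0 is feasible for sufficiently large c; a minimiser exists. Lowering every v to v_bar keeps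
  the point feasible and does not touch the objective.
\<close>

(* Importing Determinant reactivates the notation removed in Defs. *)
no_notation vec_index (infixl "$" 100)
no_notation scalar_prod (infix "\<bullet>" 70)

section \<open>Continuity and monotonicity of the bound in the volume fraction\<close>

text \<open>If v and w lie on different sides of the threshold, the estimate is chained through the
  threshold itself, where the two pieces agree. The test is kept in the product form
  \<open>v * p \<le> c\<close> because \<open>p\<close> may vanish; dividing by it is safe once both
  pieces occur.\<close>

lemma glue_continuous_mono_on:
  fixes f g h :: "real \<Rightarrow> real"
  assumes g: "continuous_on {0..1} g" "mono_on {0..1} g"
    and h: "continuous_on {0..1} h" "mono_on {0..1} h"
    and p: "0 \<le> p"
    and agree: "\<And>v. v \<in> {0..1} \<Longrightarrow> v * p = c \<Longrightarrow> g v = h v"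
    and f: "\<And>v. v \<in> {0..1} \<Longrightarrow> f v = (if v * p \<le> c then g v else h v)"
  shows "continuous_on {0..1} f" and "mono_on {0..1} f"
proof -
  have "continuous_on {0..1} (\<lambda>v. if v * p \<le> c then g v else h v)"
    by (rule continuous_on_cases_le)
      (auto intro!: continuous_intros agree intro: continuous_on_subset[OF g(1)] continuous_on_subset[OF h(1)])
  then show "continuous_on {0..1} f"
    by (rule continuous_on_eq) (simp add: f)
  show "mono_on {0..1} f"
  proof (rule mono_onI)
    fix v w :: real
    assume vw: "v \<in> {0..1}" "w \<in> {0..1}" "v \<le> w"
    have le: "v * p \<le> w * p"
      using vw p by (simp add: mult_right_mono)
    consider "w * p \<le> c" | "c < v * p" | "v * p \<le> c" "c < w * p"
      by linarith
    then show "f v \<le> f w"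
    proof cases
      case 1
      then show ?thesis
        using vw le mono_onD[OF g(2) vw] by (simp add: f)
    next
      case 2
      then show ?thesis
        using vw le mono_onD[OF h(2) vw] by (simp add: f)
    next
      case 3
      then have p0: "0 < p"
        using vw p by (cases "p = 0") auto
      define u where "u = c / p"
      have u: "u * p = c" "v \<le> u" "u \<le> w"
        using p0 3 by (auto simp: u_def field_simps)
      then have "u \<in> {0..1}"
        using vw by auto
      then have "g v \<le> h u" "h u \<le> h w"
        using mono_onD[OF g(2), of v u] mono_onD[OF h(2), of u w] agree[of u] u vw by auto
      then show ?thesis
        using vw 3 by (simp add: f)
    qed
  qed
qed

text \<open>\<open>D \<le> A * C\<close> says that the slope C - D / A at 0, the smallest one on
  [0,1], is nonnegative. Up to additive constants each regime has this form, with B one of a + b, a,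
  b.\<close>

lemma branch_continuous_mono_on:
  fixes A B C D :: real
  assumes B: "0 \<le> B" "B < A" and D: "0 \<le> D" "D \<le> A * C"
  shows "continuous_on {0..1} (\<lambda>v. v * C - D * (v * (1 - v)) / (A - B * v))" (is "continuous_on _ ?f")
    and "mono_on {0..1} (\<lambda>v. v * C - D * (v * (1 - v)) / (A - B * v))"
proof -
  have pos: "0 < A - B * v" if "v \<in> {0..1}" for v
    using that B mult_left_mono[of v 1 B] by auto
  show "continuous_on {0..1} ?f"
    using pos by (intro continuous_intros) (metis less_irrefl)
  have A: "0 < A"
    using B by simp
  \<comment> \<open>splits off the slope of ?f at 0; what remains is a multiple of an increasing fraction\<close>
  have eq: "?f v = v * (C - D / A) + D * (A - B) / A * (v\<^sup>2 / (A - B * v))" if "v \<in> {0..1}" for v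
    using pos[OF that] A by (simp add: field_simps power2_eq_square)
  show "mono_on {0..1} ?f"
  proof (rule mono_onI)
    fix v w :: real
    assume vw: "v \<in> {0..1}" "w \<in> {0..1}" "v \<le> w"
    have "v\<^sup>2 / (A - B * v) \<le> w\<^sup>2 / (A - B * w)"
      using vw B pos by (intro frac_le) (auto simp: power_mono mult_left_mono)
    moreover have "0 \<le> D * (A - B) / A" "0 \<le> C - D / A"
      using A B D by (simp_all add: pos_divide_le_eq mult.commute)
    ultimately show "?f v \<le> ?f w"
      unfolding eq[OF vw(1)] eq[OF vw(2)] using vw
      by (intro add_mono mult_left_mono mult_right_mono) auto
  qed
qed

text \<open>Increase of the bound f_HS over its value at volume fraction 0, in terms of
  A = \<kappa>p + \<mu>p, a = \<Delta>\<kappa>, b = \<Delta>\<mu>; interchanging (a, t) and (b, s) exchanges the last two regimes.\<close>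
definition hs_gain :: "real \<Rightarrow> real \<Rightarrow> real \<Rightarrow> real \<Rightarrow> real \<Rightarrow> real \<Rightarrow> real" where
  "hs_gain A a b t s v = v * (a * t\<^sup>2 + b * s\<^sup>2) -
     (if v * t * a \<le> (A - a * v) * s \<and> v * s * b \<le> (A - b * v) * t
      then v * (1 - v) * (a * t - b * s)\<^sup>2 / (A - (a + b) * v)
      else if v * t * a > (A - a * v) * s
      then (1 - v) * (v * t\<^sup>2 * a\<^sup>2 / (A - a * v) - s\<^sup>2 * b)
      else (1 - v) * (v * s\<^sup>2 * b\<^sup>2 / (A - b * v) - t\<^sup>2 * a))"

text \<open>The regime tests are homogeneous of degree one in (t, s), so scaling keeps the regime,
  and every term is homogeneous of degree two.\<close>

lemma hs_gain_scale:
  assumes "0 < r"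
  shows "hs_gain A a b (r * t) (r * s) v = r\<^sup>2 * hs_gain A a b t s v"
proof -
  have "v * (r * x) * y \<le> z * (r * u) \<longleftrightarrow> v * x * y \<le> z * u" for x y z u
    using mult_le_cancel_left_pos[OF assms, of "v * x * y" "z * u"] by (simp add: mult_ac)
  \<comment> \<open>The negated copy serves the strict test that selects the second regime.\<close>
  note le = this this[THEN arg_cong[of _ _ Not], unfolded not_le]
  have sq: "(a * (r * t) - b * (r * s))\<^sup>2 = r\<^sup>2 * (a * t - b * s)\<^sup>2"
    by (simp add: power2_eq_square algebra_simps)
  show ?thesis
    unfolding hs_gain_def le sq
    by (simp add: power_mult_distrib algebra_simps)
qed

text \<open>The tests are affine in v, so each switches at most once. In the application A - (a + b)
  is the sum of the two moduli of the weak phase, hence positive.\<close>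

lemma hs_gain_continuous_mono_on:
  assumes ab: "0 < a" "0 < b" "a + b < A" and ts: "0 \<le> t" "0 \<le> s"
  shows "continuous_on {0..1} (hs_gain A a b t s)" and "mono_on {0..1} (hs_gain A a b t s)"
proof -
  \<comment> \<open>\<open>g\<close> is the gain in the first regime, \<open>h a b t s\<close> in
    the second and \<open>h b a s t\<close> in the third. In \<open>h\<close> the parts v and 1 - v
    of the term with b have added up to a constant.\<close>
  define g where "g a b t s v = v * (a * t\<^sup>2 + b * s\<^sup>2) - (a * t - b * s)\<^sup>2 * (v * (1 - v)) / (A - (a + b) * v)"
    for a b t s v :: real
  define h where "h a b t s v = b * s\<^sup>2 + (v * (a * t\<^sup>2) - (a * t)\<^sup>2 * (v * (1 - v)) / (A - a * v))"
    for a b t s v :: real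
  have two_branches: "continuous_on {0..1} f \<and> mono_on {0..1} f"
    if ab: "0 < a" "0 < b" "a + b < A" and ts: "0 \<le> t" "0 \<le> s"
      and f: "\<And>v. v \<in> {0..1} \<Longrightarrow> f v = (if v * (a * (t + s)) \<le> A * s then g a b t s v else h a b t s v)"
    for a b t s :: real and f
  proof -
    have sq: "(r * x)\<^sup>2 \<le> A * (r * x\<^sup>2)" if "0 \<le> r" "r \<le> A" for r x :: real
      using mult_right_mono[of r A "r * x\<^sup>2"] that by (simp add: power2_eq_square algebra_simps)
    \<comment> \<open>This yields the slope condition of \<open>branch_continuous_mono_on\<close>
      for \<open>g\<close>: the mixed term is nonpositive, and a and b are at most A.\<close>
    have "(a * t - b * s)\<^sup>2 \<le> (a * t)\<^sup>2 + (b * s)\<^sup>2"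
      using ab ts by (simp add: power2_diff)
    also have "\<dots> \<le> A * (a * t\<^sup>2 + b * s\<^sup>2)"
      using sq[of a t] sq[of b s] ab by (simp add: distrib_left)
    finally have "continuous_on {0..1} (g a b t s)" "mono_on {0..1} (g a b t s)"
      unfolding g_def using ab by (intro branch_continuous_mono_on; simp)+
    moreover have "continuous_on {0..1} (h a b t s)" "mono_on {0..1} (h a b t s)"
      unfolding h_def using ab sq[of a t] branch_continuous_mono_on[of a A "(a * t)\<^sup>2" "a * t\<^sup>2"]
      by (auto intro!: continuous_intros simp: mono_on_def)
    moreover have "g a b t s v = h a b t s v" if v: "v \<in> {0..1}" and thr: "v * (a * (t + s)) = A * s" for v
    proof -
      have "(a + b) * v \<le> a + b" "a * v \<le> a"
        using v ab by (intro mult_right_le_one_le; simp)+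
      then have pos: "0 < A - a * v" "0 < A - (a + b) * v"
        using ab by linarith+
      \<comment> \<open>At the threshold this identity turns a factor of the numerator of
        \<open>h\<close> into s times its denominator; subtracting v * b * s on both sides does the
        same for \<open>g\<close>.\<close>
      have at: "v * (a * t) = s * (A - a * v)"
        using thr by (simp add: algebra_simps)
      then have diff: "v * (a * t - b * s) = s * (A - (a + b) * v)"
        by (simp add: algebra_simps)
      have "(a * t)\<^sup>2 * (v * (1 - v)) / (A - a * v) = (1 - v) * (a * t) * (v * (a * t)) / (A - a * v)"
        by (simp add: power2_eq_square)
      also have "\<dots> = (1 - v) * (a * t) * s"
        unfolding at using pos by simp
      finally have 1: "(a * t)\<^sup>2 * (v * (1 - v)) / (A - a * v) = (1 - v) * (a * t) * s" .
      have "(a * t - b * s)\<^sup>2 * (v * (1 - v)) / (A - (a + b) * v) =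
          (1 - v) * (a * t - b * s) * (v * (a * t - b * s)) / (A - (a + b) * v)"
        by (simp add: power2_eq_square)
      also have "\<dots> = (1 - v) * (a * t - b * s) * s"
        unfolding diff using pos by simp
      finally show ?thesis
        unfolding g_def h_def 1 by (simp add: power2_eq_square algebra_simps)
    qed
    ultimately show ?thesis
      using glue_continuous_mono_on[of "g a b t s" "h a b t s" "a * (t + s)" "A * s" f] f ab ts by simp
  qed
  have R2: "v * t * a \<le> (A - a * v) * s \<longleftrightarrow> v * (a * (t + s)) \<le> A * s"
    and R3: "v * s * b \<le> (A - b * v) * t \<longleftrightarrow> v * (b * (s + t)) \<le> A * t" for v
    by (auto simp: algebra_simps)
  have le: "v * x \<le> x" if "v \<in> {0..1}" "0 \<le> x" for v x :: real
    using that by (auto intro: mult_left_le_one_le)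
  have swap: "g b a s t v = g a b t s v" for v
    by (simp add: g_def algebra_simps power2_eq_square)
  have eq2: "v * (a * t\<^sup>2 + b * s\<^sup>2) - (1 - v) * (v * t\<^sup>2 * a\<^sup>2 / (A - a * v) - s\<^sup>2 * b) = h a b t s v"
    and eq3: "v * (a * t\<^sup>2 + b * s\<^sup>2) - (1 - v) * (v * s\<^sup>2 * b\<^sup>2 / (A - b * v) - t\<^sup>2 * a) = h b a s t v" for v
    by (simp_all add: h_def algebra_simps power2_eq_square)
  have eq1: "v * (a * t\<^sup>2 + b * s\<^sup>2) - v * (1 - v) * (a * t - b * s)\<^sup>2 / (A - (a + b) * v) = g a b t s v" for v
    by (simp add: g_def mult.commute)
  have gain: "hs_gain A a b t s v =
      (if v * (a * (t + s)) \<le> A * s \<and> v * (b * (s + t)) \<le> A * t then g a b t s v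
       else if \<not> v * (a * (t + s)) \<le> A * s then h a b t s v else h b a s t v)" for v
    unfolding hs_gain_def R2[symmetric] R3[symmetric] eq1[symmetric] eq2[symmetric] eq3[symmetric]
    by (simp add: not_le)
  \<comment> \<open>at most one of the last two regimes occurs as v runs through [0,1]\<close>
  have "(a + b) * (s + t) \<le> A * (s + t)"
    using ab ts by (intro mult_right_mono) auto
  then have "b * (s + t) \<le> A * t \<or> a * (t + s) \<le> A * s"
    by (simp add: algebra_simps) argo
  then have "continuous_on {0..1} (hs_gain A a b t s) \<and> mono_on {0..1} (hs_gain A a b t s)"
  proof
    assume *: "b * (s + t) \<le> A * t"
    \<comment> \<open>The left side is largest at v = 1, so the third regime never occurs and only
      the switch from \<open>g\<close> to \<open>h a b t s\<close> remains.\<close>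
    have "v * (b * (s + t)) \<le> A * t" if "v \<in> {0..1}" for v
      by (rule order_trans[OF le[OF that] *]) (use ab ts in simp)
    then show ?thesis
      using ab ts by (intro two_branches[of a b t s]) (auto simp: gain)
  next
    assume *: "a * (t + s) \<le> A * s"
    have "v * (a * (t + s)) \<le> A * s" if "v \<in> {0..1}" for v
      by (rule order_trans[OF le[OF that] *]) (use ab ts in simp)
    then show ?thesis
      using ab ts by (intro two_branches[of b a s t]) (auto simp: gain swap)
  qed
  then show "continuous_on {0..1} (hs_gain A a b t s)" and "mono_on {0..1} (hs_gain A a b t s)"
    by auto
qed

section \<open>The bound as a function of strain and volume fraction\<close>

text \<open>The deviator of a symmetric matrix with eigenvalues x, y has squared norm (x - y)^2 / 2,
  and (x - y)^2 is the squared trace minus four times the determinant.\<close>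

lemma iso_tensor_energy:
  assumes "\<epsilon> \<in> sym2"
  shows "tensor_app (iso_tensor \<kappa> \<mu>) \<epsilon> \<bullet> \<epsilon> = \<kappa> * (trace \<epsilon>)\<^sup>2 + \<mu> * ((trace \<epsilon>)\<^sup>2 - 4 * Determinants.det \<epsilon>)"
  using assms
  by (simp add: mem_sym2 tensor_app_def iso_tensor_def inner_vec_def sum_2 trace_def det_2
      power2_eq_square) (simp add: algebra_simps)

lemma discriminant_eq:
  assumes "\<epsilon> \<in> sym2"
  shows "(trace \<epsilon>)\<^sup>2 - 4 * Determinants.det \<epsilon> = (\<epsilon>$1$1 - \<epsilon>$2$2)\<^sup>2 + 4 * (\<epsilon>$1$2)\<^sup>2"
  using assms by (simp add: mem_sym2 trace_def sum_2 det_2 power2_eq_square algebra_simps)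

lemma discriminant_nonneg:
  assumes "\<epsilon> \<in> sym2"
  shows "0 \<le> (trace \<epsilon>)\<^sup>2 - 4 * Determinants.det \<epsilon>"
  by (simp add: discriminant_eq[OF assms])

lemma tensor_app_linear:
  "tensor_app (E + F) \<epsilon> = tensor_app E \<epsilon> + tensor_app F \<epsilon>"
  "tensor_app (E - F) \<epsilon> = tensor_app E \<epsilon> - tensor_app F \<epsilon>"
  "tensor_app (r *\<^sub>R E) \<epsilon> = r *\<^sub>R tensor_app E \<epsilon>"
  "tensor_app E (\<epsilon> + \<eta>) = tensor_app E \<epsilon> + tensor_app E \<eta>"
  "tensor_app E (\<epsilon> - \<eta>) = tensor_app E \<epsilon> - tensor_app E \<eta>"
  "tensor_app E (r *\<^sub>R \<epsilon>) = r *\<^sub>R tensor_app E \<epsilon>"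
  by (simp_all add: tensor_app_def matrix2_eq_iff sum_2 algebra_simps)

text \<open>The phase mixture is affine in v, so its v-free part, the weak-phase energy, splits off;
  questions about v then concern the scalar function \<open>hs_gain\<close> alone.\<close>

lemma f_HS_eq:
  assumes "\<epsilon> \<in> sym2"
  shows "f_HS \<kappa>m \<kappa>p \<mu>m \<mu>p \<epsilon> v =
    tensor_app (iso_tensor \<kappa>m \<mu>m) \<epsilon> \<bullet> \<epsilon>
    + hs_gain (\<kappa>p + \<mu>p) (\<kappa>p - \<kappa>m) (\<mu>p - \<mu>m) \<bar>trace \<epsilon>\<bar> (sqrt ((trace \<epsilon>)\<^sup>2 - 4 * Determinants.det \<epsilon>)) v"
proof -
  have "tensor_app ((1 - v) *\<^sub>R iso_tensor \<kappa>m \<mu>m + v *\<^sub>R iso_tensor \<kappa>p \<mu>p) \<epsilon> \<bullet> \<epsilon> =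
    tensor_app (iso_tensor \<kappa>m \<mu>m) \<epsilon> \<bullet> \<epsilon> +
    v * ((\<kappa>p - \<kappa>m) * \<bar>trace \<epsilon>\<bar>\<^sup>2 + (\<mu>p - \<mu>m) * (sqrt ((trace \<epsilon>)\<^sup>2 - 4 * Determinants.det \<epsilon>))\<^sup>2)"
    using discriminant_nonneg[OF assms]
    by (simp add: tensor_app_linear inner_add_left iso_tensor_energy[OF assms]) (simp add: algebra_simps)
  then show ?thesis
    unfolding f_HS_def hs_q_def hs_gain_def Let_def by simp
qed

text \<open>The trace and the square root both scale by r, which reduces this to
  \<open>hs_gain_scale\<close>. It carries inequalities from a sphere to all nonzero
  strains.\<close>

lemma f_HS_scale:
  assumes "\<epsilon> \<in> sym2" "0 < r"
  shows "f_HS \<kappa>m \<kappa>p \<mu>m \<mu>p (r *\<^sub>R \<epsilon>) v = r\<^sup>2 * f_HS \<kappa>m \<kappa>p \<mu>m \<mu>p \<epsilon> v"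
proof -
  have "r *\<^sub>R \<epsilon> \<in> sym2"
    using assms by (simp add: mem_sym2)
  moreover have "\<bar>trace (r *\<^sub>R \<epsilon>)\<bar> = r * \<bar>trace \<epsilon>\<bar>"
    using assms(2) by (simp add: trace_def sum_distrib_left[symmetric] abs_mult)
  moreover have "(trace (r *\<^sub>R \<epsilon>))\<^sup>2 - 4 * Determinants.det (r *\<^sub>R \<epsilon>) = r\<^sup>2 * ((trace \<epsilon>)\<^sup>2 - 4 * Determinants.det \<epsilon>)"
    by (simp add: trace_def sum_2 det_2 power2_eq_square algebra_simps)
  moreover have "sqrt (r\<^sup>2 * x) = r * sqrt x" for x
    using assms(2) by (simp add: real_sqrt_mult)
  ultimately show ?thesis
    using assms by (simp add: f_HS_eq hs_gain_scale tensor_app_linear power2_eq_square distrib_left)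
qed

lemma f_HS_continuous_mono_on:
  assumes "0 < \<kappa>m" "\<kappa>m < \<kappa>p" "0 < \<mu>m" "\<mu>m < \<mu>p" "\<epsilon> \<in> sym2"
  shows "continuous_on {0..1} (f_HS \<kappa>m \<kappa>p \<mu>m \<mu>p \<epsilon>)" and "mono_on {0..1} (f_HS \<kappa>m \<kappa>p \<mu>m \<mu>p \<epsilon>)"
proof -
  note h = hs_gain_continuous_mono_on[of "\<kappa>p - \<kappa>m" "\<mu>p - \<mu>m" "\<kappa>p + \<mu>p" "\<bar>trace \<epsilon>\<bar>"
      "sqrt ((trace \<epsilon>)\<^sup>2 - 4 * Determinants.det \<epsilon>)"]
  show "continuous_on {0..1} (f_HS \<kappa>m \<kappa>p \<mu>m \<mu>p \<epsilon>)"
    unfolding f_HS_eq[OF assms(5), abs_def] using h(1) assms discriminant_nonneg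
    by (intro continuous_intros) auto
  show "mono_on {0..1} (f_HS \<kappa>m \<kappa>p \<mu>m \<mu>p \<epsilon>)"
    unfolding f_HS_eq[OF assms(5), abs_def] mono_on_def using h(2) assms discriminant_nonneg
    by (auto simp: mono_on_def)
qed

text \<open>At v = 0 both tests of the first regime hold, and its subtracted term has the factor
  v.\<close>

lemma f_HS_0:
  assumes "0 < \<kappa>m" "\<kappa>m < \<kappa>p" "0 < \<mu>m" "\<mu>m < \<mu>p" "\<epsilon> \<in> sym2"
  shows "f_HS \<kappa>m \<kappa>p \<mu>m \<mu>p \<epsilon> 0 = tensor_app (iso_tensor \<kappa>m \<mu>m) \<epsilon> \<bullet> \<epsilon>"
  using assms discriminant_nonneg by (simp add: f_HS_eq hs_gain_def)

lemma f_HS_1: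
  assumes "\<epsilon> \<in> sym2"
  shows "f_HS \<kappa>m \<kappa>p \<mu>m \<mu>p \<epsilon> 1 = tensor_app (iso_tensor \<kappa>p \<mu>p) \<epsilon> \<bullet> \<epsilon>"
  by (simp add: f_HS_def hs_q_def Let_def)

section \<open>Least admissible volume fractions\<close>

text \<open>\<open>LEAST\<close> over the reals is meaningful only if a minimum is attained:
  continuity of the bound makes the set of candidates compact, and \<open>w\<close> shows that it is
  nonempty.\<close>

lemma v_hat_least:
  assumes "0 < \<kappa>m" "\<kappa>m < \<kappa>p" "0 < \<mu>m" "\<mu>m < \<mu>p" and \<epsilon>: "\<epsilon> \<in> sym2"
    and w: "w \<in> {0..1}" "tensor_app E \<epsilon> \<bullet> \<epsilon> \<le> f_HS \<kappa>m \<kappa>p \<mu>m \<mu>p \<epsilon> w"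
  shows "v_hat \<kappa>m \<kappa>p \<mu>m \<mu>p \<epsilon> E \<in> {0..1}"
    and "tensor_app E \<epsilon> \<bullet> \<epsilon> \<le> f_HS \<kappa>m \<kappa>p \<mu>m \<mu>p \<epsilon> (v_hat \<kappa>m \<kappa>p \<mu>m \<mu>p \<epsilon> E)"
    and "v_hat \<kappa>m \<kappa>p \<mu>m \<mu>p \<epsilon> E \<le> w"
proof -
  let ?T = "{v \<in> {0..1}. tensor_app E \<epsilon> \<bullet> \<epsilon> \<le> f_HS \<kappa>m \<kappa>p \<mu>m \<mu>p \<epsilon> v}"
  have "closed ?T"
    by (intro continuous_on_closed_Collect_le continuous_on_const f_HS_continuous_mono_on assms) simp
  moreover have "bounded ?T"
    by (rule bounded_subset[of "{0..1}"]) auto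
  ultimately have "compact ?T"
    by (simp add: compact_eq_bounded_closed)
  then obtain u where u: "u \<in> ?T" "\<forall>v\<in>?T. u \<le> v"
    using compact_attains_inf[of ?T] w by blast
  have "v_hat \<kappa>m \<kappa>p \<mu>m \<mu>p \<epsilon> E = u"
    unfolding v_hat_def by (rule Least_equality) (use u in auto)
  then show "v_hat \<kappa>m \<kappa>p \<mu>m \<mu>p \<epsilon> E \<in> {0..1}"
    and "tensor_app E \<epsilon> \<bullet> \<epsilon> \<le> f_HS \<kappa>m \<kappa>p \<mu>m \<mu>p \<epsilon> (v_hat \<kappa>m \<kappa>p \<mu>m \<mu>p \<epsilon> E)"
    and "v_hat \<kappa>m \<kappa>p \<mu>m \<mu>p \<epsilon> E \<le> w"
    using u w by auto
qed

text \<open>Each \<open>v_hat\<close> is at most \<open>w\<close>, hence so is their supremum.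
  Raising v from \<open>v_hat\<close> to the supremum keeps each inequality, by
  monotonicity.\<close>

lemma v_bar_least:
  assumes pos: "0 < \<kappa>m" "\<kappa>m < \<kappa>p" "0 < \<mu>m" "\<mu>m < \<mu>p"
    and w: "w \<in> {0..1}" "E \<in> A2 \<kappa>m \<kappa>p \<mu>m \<mu>p w"
  shows "v_bar \<kappa>m \<kappa>p \<mu>m \<mu>p E \<in> {0..1}"
    and "E \<in> A2 \<kappa>m \<kappa>p \<mu>m \<mu>p (v_bar \<kappa>m \<kappa>p \<mu>m \<mu>p E)"
    and "v_bar \<kappa>m \<kappa>p \<mu>m \<mu>p E \<le> w"
proof -
  let ?v = "v_bar \<kappa>m \<kappa>p \<mu>m \<mu>p E"
  let ?S = "{v_hat \<kappa>m \<kappa>p \<mu>m \<mu>p \<epsilon> E | \<epsilon>. \<epsilon> \<in> sym2 \<and> norm \<epsilon> = sqrt 2 / 2}"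
  have w': "tensor_app E \<epsilon> \<bullet> \<epsilon> \<le> f_HS \<kappa>m \<kappa>p \<mu>m \<mu>p \<epsilon> w" if "\<epsilon> \<in> sym2" for \<epsilon>
    using w(2) that by (simp add: A2_def)
  note hat = v_hat_least[OF pos _ w(1) w']
  have normalise: "\<exists>r \<eta>. 0 < r \<and> \<eta> \<in> sym2 \<and> norm \<eta> = sqrt 2 / 2 \<and> \<epsilon> = r *\<^sub>R \<eta>"
    if "\<epsilon> \<in> sym2" "\<epsilon> \<noteq> 0" for \<epsilon>
  proof (intro exI conjI)
    let ?r = "norm \<epsilon> / (sqrt 2 / 2)"
    show "0 < ?r"
      using that by simp
    show "(1 / ?r) *\<^sub>R \<epsilon> \<in> sym2"
      using that by (simp add: mem_sym2)
    show "norm ((1 / ?r) *\<^sub>R \<epsilon>) = sqrt 2 / 2"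
      using that by simp
    show "\<epsilon> = ?r *\<^sub>R ((1 / ?r) *\<^sub>R \<epsilon>)"
      using that by simp
  qed
  \<comment> \<open>The supremum needs a nonempty set; the identity matrix, rescaled to the sphere,
    provides a member.\<close>
  have ne: "?S \<noteq> {}"
    using normalise[of "Finite_Cartesian_Product.mat 1"]
    by (auto simp: mem_sym2 Finite_Cartesian_Product.mat_def matrix2_eq_iff)
  have bdd: "bdd_above ?S"
    using hat(3) by (auto intro!: bdd_aboveI[of _ w])
  show le: "?v \<le> w"
    unfolding v_bar_def using hat(3) by (intro cSup_least[OF ne]) auto
  have upper: "v_hat \<kappa>m \<kappa>p \<mu>m \<mu>p \<epsilon> E \<le> ?v" if "\<epsilon> \<in> sym2" "norm \<epsilon> = sqrt 2 / 2" for \<epsilon>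
    unfolding v_bar_def using that by (intro cSup_upper bdd) auto
  obtain \<epsilon> where "\<epsilon> \<in> sym2" "norm \<epsilon> = sqrt 2 / 2"
    using ne by blast
  then have "0 \<le> ?v"
    using hat(1)[of \<epsilon>] upper[of \<epsilon>] by auto
  then show v: "?v \<in> {0..1}"
    using le w(1) by auto
  have unit: "tensor_app E \<epsilon> \<bullet> \<epsilon> \<le> f_HS \<kappa>m \<kappa>p \<mu>m \<mu>p \<epsilon> ?v"
    if "\<epsilon> \<in> sym2" "norm \<epsilon> = sqrt 2 / 2" for \<epsilon>
    using hat(2)[OF that(1) that(1)]
      mono_onD[OF f_HS_continuous_mono_on(2)[OF pos that(1)] hat(1)[OF that(1) that(1)] v upper[OF that]]
    by linarith
  \<comment> \<open>A nonzero strain is a positive multiple of one on the sphere, and both sides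
    scale by r^2; at the zero strain both vanish.\<close>
  have "tensor_app E \<epsilon> \<bullet> \<epsilon> \<le> f_HS \<kappa>m \<kappa>p \<mu>m \<mu>p \<epsilon> ?v" if \<epsilon>: "\<epsilon> \<in> sym2" for \<epsilon>
  proof (cases "\<epsilon> = 0")
    case True
    then show ?thesis
      by (simp add: f_HS_def hs_q_def trace_def det_2)
  next
    case False
    then obtain r \<eta> where r: "0 < r" "\<eta> \<in> sym2" "norm \<eta> = sqrt 2 / 2" "\<epsilon> = r *\<^sub>R \<eta>"
      using normalise \<epsilon> by blast
    then show ?thesis
      using unit[of \<eta>] by (simp add: f_HS_scale tensor_app_linear power2_eq_square)
  qed
  then show "E \<in> A2 \<kappa>m \<kappa>p \<mu>m \<mu>p ?v"
    using w(2) by (simp add: A2_def)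
qed

lemma v_bar_eq_Inf:
  assumes "0 < \<kappa>m" "\<kappa>m < \<kappa>p" "0 < \<mu>m" "\<mu>m < \<mu>p"
    and "w \<in> {0..1}" "E \<in> A2 \<kappa>m \<kappa>p \<mu>m \<mu>p w"
  shows "v_bar \<kappa>m \<kappa>p \<mu>m \<mu>p E = Inf {u \<in> {0..1}. E \<in> A2 \<kappa>m \<kappa>p \<mu>m \<mu>p u}"
  \<comment> \<open>The instance at \<open>w\<close> gives membership; the third fact with its
    volume fraction left free gives the lower bound, so the infimum is a minimum.\<close>
  using v_bar_least[OF assms] v_bar_least(3)[OF assms(1-4)]
  by (intro cInf_eq_minimum[symmetric]) auto

section \<open>Admissible tensors: norm bound, weak phase, symmetrisation\<close>

lemma norm_vec_le_sum: "norm x \<le> (\<Sum>i\<in>UNIV. norm (x $ i))"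
  unfolding norm_vec_def by (rule L2_set_le_sum) simp

text \<open>By monotonicity the energy of an admissible tensor lies between 0 and that of the strong
  phase, whatever v is; polarisation turns this into a bound on the entries.\<close>

lemma A2_bounded:
  assumes pos: "0 < \<kappa>m" "\<kappa>m < \<kappa>p" "0 < \<mu>m" "\<mu>m < \<mu>p"
  shows "\<exists>C. \<forall>v\<in>{0..1}. \<forall>E \<in> A2 \<kappa>m \<kappa>p \<mu>m \<mu>p v. norm E \<le> C"
proof -
  \<comment> \<open>The matrix units \<open>U\<close> read off entries, but the energy bounds hold
    on \<open>sym2\<close> only, so the symmetrised units \<open>S\<close> are used as test
    strains.\<close>
  define U :: "2 \<Rightarrow> 2 \<Rightarrow> real^2^2" where "U k l = axis k (axis l 1)" for k l
  define S where "S k l = (1 / 2) *\<^sub>R (U k l + U l k)" for k l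
  define q where "q \<epsilon> = tensor_app (iso_tensor \<kappa>p \<mu>p) \<epsilon> \<bullet> \<epsilon>" for \<epsilon>
  define C where "C i j k l = q (S i j + S k l) + q (S i j - S k l)" for i j k l
  have "tensor_app E (U k l) $ i $ j = E $ i $ j $ k $ l" for E i j k l
    using exhaust_2[of k] exhaust_2[of l]
    by (auto simp: U_def tensor_app_def sum_2 axis_def)
  then have app_U: "tensor_app E (U k l) \<bullet> U i j = E $ i $ j $ k $ l" for E i j k l
    by (simp add: U_def[of i j] inner_axis)
  have S_sym: "S k l \<in> sym2" for k l
    by (auto simp: mem_sym2 S_def U_def axis_def)
  have pm: "S i j + S k l \<in> sym2" "S i j - S k l \<in> sym2" for i j k l
    using S_sym[of i j] S_sym[of k l] by (simp_all add: mem_sym2)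
  have "norm E \<le> (\<Sum>i\<in>UNIV. \<Sum>j\<in>UNIV. \<Sum>k\<in>UNIV. \<Sum>l\<in>UNIV. C i j k l)"
    if v: "v \<in> {0..1}" and E: "E \<in> A2 \<kappa>m \<kappa>p \<mu>m \<mu>p v" for v E
  proof -
    have E4: "E \<in> sym4" and lower: "loewner_le (iso_tensor \<kappa>m \<mu>m) E"
      and upper: "\<And>\<epsilon>. \<epsilon> \<in> sym2 \<Longrightarrow> tensor_app E \<epsilon> \<bullet> \<epsilon> \<le> f_HS \<kappa>m \<kappa>p \<mu>m \<mu>p \<epsilon> v"
      using E by (auto simp: A2_def)
    have Q: "0 \<le> tensor_app E \<epsilon> \<bullet> \<epsilon>" "tensor_app E \<epsilon> \<bullet> \<epsilon> \<le> q \<epsilon>" if \<epsilon>: "\<epsilon> \<in> sym2" for \<epsilon>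
    proof -
      have "0 \<le> tensor_app (iso_tensor \<kappa>m \<mu>m) \<epsilon> \<bullet> \<epsilon>"
        using pos discriminant_nonneg[OF \<epsilon>] by (simp add: iso_tensor_energy[OF \<epsilon>])
      then show "0 \<le> tensor_app E \<epsilon> \<bullet> \<epsilon>"
        using lower \<epsilon> by (fastforce simp: loewner_le_def tensor_app_linear inner_diff_left)
      show "tensor_app E \<epsilon> \<bullet> \<epsilon> \<le> q \<epsilon>"
        using upper[OF \<epsilon>] mono_onD[OF f_HS_continuous_mono_on(2)[OF pos \<epsilon>] v, of 1] v
        by (simp add: q_def f_HS_1[OF \<epsilon>])
    qed
    have "\<bar>E $ i $ j $ k $ l\<bar> \<le> C i j k l" for i j k l
    proof -
      have "tensor_app E (S k l) \<bullet> S i j =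
          (E $ i $ j $ k $ l + E $ i $ j $ l $ k + E $ j $ i $ k $ l + E $ j $ i $ l $ k) / 4"
        by (simp add: S_def tensor_app_linear inner_add_left inner_add_right app_U)
          (simp add: field_simps)
      also have "\<dots> = E $ i $ j $ k $ l"
        using sym4D(1,2)[OF E4] by simp
      finally have "E $ i $ j $ k $ l = tensor_app E (S k l) \<bullet> S i j" by simp
      moreover have "tensor_app E (S i j) \<bullet> S k l = tensor_app E (S k l) \<bullet> S i j"
        using sym4_app(2)[OF E4] by (simp add: inner_commute)
      \<comment> \<open>Polarisation: both energies lie between 0 and the matching \<open>q\<close>,
        so their difference is at most \<open>C\<close> in absolute value.\<close>
      ultimately have "4 * E $ i $ j $ k $ l =
          tensor_app E (S i j + S k l) \<bullet> (S i j + S k l) - tensor_app E (S i j - S k l) \<bullet> (S i j - S k l)"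
        by (simp add: tensor_app_linear inner_add_left inner_add_right inner_diff_left inner_diff_right)
      then show ?thesis
        using Q[OF pm(1)[of i j k l]] Q[OF pm(2)[of i j k l]] unfolding C_def by linarith
    qed
    then show ?thesis
      by (intro order_trans[OF norm_vec_le_sum] sum_mono) simp
  qed
  then show ?thesis by blast
qed

text \<open>The trace and the eigenvalue gap vanish together only for the zero strain.\<close>

lemma iso_tensor_pos:
  assumes "0 < \<kappa>" "0 < \<mu>"
  shows "loewner_less 0 (iso_tensor \<kappa> \<mu>)"
  unfolding loewner_less_def
proof (intro ballI impI)
  fix \<epsilon> :: "real^2^2"
  assume \<epsilon>: "\<epsilon> \<in> sym2" "\<epsilon> \<noteq> 0"
  have "trace \<epsilon> \<noteq> 0 \<or> (\<epsilon>$1$1 - \<epsilon>$2$2)\<^sup>2 + 4 * (\<epsilon>$1$2)\<^sup>2 \<noteq> 0"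
    using \<epsilon> by (auto simp: mem_sym2 trace_def sum_2 matrix2_eq_iff add_nonneg_eq_0_iff)
  then have "0 < \<kappa> * (trace \<epsilon>)\<^sup>2 + \<mu> * ((\<epsilon>$1$1 - \<epsilon>$2$2)\<^sup>2 + 4 * (\<epsilon>$1$2)\<^sup>2)"
  proof
    assume "trace \<epsilon> \<noteq> 0"
    then show ?thesis
      using assms by (intro add_pos_nonneg) auto
  next
    assume "(\<epsilon>$1$1 - \<epsilon>$2$2)\<^sup>2 + 4 * (\<epsilon>$1$2)\<^sup>2 \<noteq> 0"
    moreover have "0 \<le> (\<epsilon>$1$1 - \<epsilon>$2$2)\<^sup>2 + 4 * (\<epsilon>$1$2)\<^sup>2"
      by simp
    ultimately have "0 < (\<epsilon>$1$1 - \<epsilon>$2$2)\<^sup>2 + 4 * (\<epsilon>$1$2)\<^sup>2"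
      by linarith
    then show ?thesis
      using assms by (simp add: add_nonneg_pos[OF _ mult_pos_pos])
  qed
  then show "0 < tensor_app (iso_tensor \<kappa> \<mu> - 0) \<epsilon> \<bullet> \<epsilon>"
    by (simp add: iso_tensor_energy[OF \<epsilon>(1)] discriminant_eq[OF \<epsilon>(1)])
qed

text \<open>Both bounds hold with equality. Volume fraction 0 makes this a candidate for every
  nonnegative volume budget.\<close>

lemma iso_tensor_mem_A2:
  assumes "0 < \<kappa>m" "\<kappa>m < \<kappa>p" "0 < \<mu>m" "\<mu>m < \<mu>p"
  shows "iso_tensor \<kappa>m \<mu>m \<in> A2 \<kappa>m \<kappa>p \<mu>m \<mu>p 0"
  using assms by (simp add: A2_def iso_tensor_sym4 loewner_le_def tensor_app_linear f_HS_0)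

text \<open>Stiffness matrices are only constrained on sym4; composing with a projection onto it makes
  them linear on the whole Euclidean space of tensors, hence continuous.\<close>
definition sym4_proj :: "tensor4 \<Rightarrow> tensor4" where
  "sym4_proj E = (\<chi> i j k l.
     (E $ i $ j $ k $ l + E $ j $ i $ k $ l + E $ i $ j $ l $ k + E $ j $ i $ l $ k
      + E $ k $ l $ i $ j + E $ l $ k $ i $ j + E $ k $ l $ j $ i + E $ l $ k $ j $ i) / 8)"

lemma sym4_proj_mem: "sym4_proj E \<in> sym4"
  unfolding sym4_def sym4_proj_def by auto

text \<open>Membership in \<open>sym4\<close> becomes an equation between continuous maps, hence a
  closed condition.\<close>

lemma sym4_proj_eq_iff: "sym4_proj E = E \<longleftrightarrow> E \<in> sym4"
proof
  show "E \<in> sym4" if "sym4_proj E = E"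
    using sym4_proj_mem[of E] that by simp
next
  assume E: "E \<in> sym4"
  have "E $ j $ i $ k $ l = E $ i $ j $ k $ l" "E $ i $ j $ l $ k = E $ i $ j $ k $ l"
    "E $ j $ i $ l $ k = E $ i $ j $ k $ l" "E $ k $ l $ i $ j = E $ i $ j $ k $ l"
    "E $ l $ k $ i $ j = E $ i $ j $ k $ l" "E $ k $ l $ j $ i = E $ i $ j $ k $ l"
    "E $ l $ k $ j $ i = E $ i $ j $ k $ l" for i j k l
    using sym4D[OF E] by metis+
  then show "sym4_proj E = E"
    by (simp add: sym4_proj_def Finite_Cartesian_Product.vec_eq_iff)
qed

lemma sym4_proj_linear:
  "sym4_proj (E + F) = sym4_proj E + sym4_proj F"
  "sym4_proj (r *\<^sub>R E) = r *\<^sub>R sym4_proj E"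
  by (simp_all add: sym4_proj_def Finite_Cartesian_Product.vec_eq_iff field_simps)

section \<open>The compliance matrix as a quadratic form\<close>

lemma compliance_mat_carrier:
  assumes "f \<in> carrier_vec n" "K \<in> carrier_mat n n"
  shows "compliance_mat c f K \<in> carrier_mat (1 + n) (1 + n)"
  unfolding compliance_mat_def using assms by (intro four_block_carrier_mat) auto

text \<open>A test vector is split into its first entry a and the rest x. For fixed a and x the
  inequality is affine in c and K, the form in which closedness of the constraint is proved.\<close>

lemma mat_psd_compliance_iff:
  assumes f: "f \<in> carrier_vec n" and K: "K \<in> carrier_mat n n" "transpose_mat K = K"
  shows "mat_psd (compliance_mat c f K) \<longleftrightarrow>
    (\<forall>a. \<forall>x\<in>carrier_vec n. 0 \<le> c * a\<^sup>2 - 2 * a * scalar_prod f x + scalar_prod x (K *\<^sub>v x))"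
proof -
  define M where "M = compliance_mat c f K"
  define A where "A = (Matrix.mat 1 1 (\<lambda>_. c))"
  define B where "B = mat_of_row (- f)"
  have A: "A \<in> carrier_mat 1 1" and B: "B \<in> carrier_mat 1 n"
    using f by (auto simp: A_def B_def)
  have M_eq: "M = four_block_mat A B (transpose_mat B) K"
    by (simp add: M_def A_def B_def compliance_mat_def)
  have M: "M \<in> carrier_mat (1 + n) (1 + n)"
    unfolding M_def by (rule compliance_mat_carrier[OF f K(1)])
  have "transpose_mat A = A"
    by (intro eq_matI) (auto simp: A_def)
  then have "transpose_mat M = M"
    unfolding M_eq using transpose_four_block_mat[OF A B _ K(1), of "transpose_mat B"] B K(2) by simp
  have form: "scalar_prod (append_vec (Matrix.vec 1 (\<lambda>_. a)) x) (M *\<^sub>v append_vec (Matrix.vec 1 (\<lambda>_. a)) x) =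
      c * a\<^sup>2 - 2 * a * scalar_prod f x + scalar_prod x (K *\<^sub>v x)" if x: "x \<in> carrier_vec n" for a x
  proof -
    let ?a = "Matrix.vec 1 (\<lambda>_. a)"
    have Aa: "A *\<^sub>v ?a = Matrix.vec 1 (\<lambda>_. c * a)"
      by (intro eq_vecI) (auto simp: A_def scalar_prod_def)
    have Bx: "B *\<^sub>v x = Matrix.vec 1 (\<lambda>_. - scalar_prod f x)"
      using f x by (intro eq_vecI) (auto simp: B_def)
    have Ca: "transpose_mat B *\<^sub>v ?a = (- a) \<cdot>\<^sub>v f"
      using f by (intro eq_vecI) (auto simp: B_def scalar_prod_def Matrix.row_def)
    have "M *\<^sub>v append_vec ?a x = append_vec (A *\<^sub>v ?a + B *\<^sub>v x) (transpose_mat B *\<^sub>v ?a + K *\<^sub>v x)"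
      unfolding M_eq using A B K(1) x by (intro four_block_mat_mult_vec) auto
    then have "scalar_prod (append_vec ?a x) (M *\<^sub>v append_vec ?a x) =
        scalar_prod ?a (A *\<^sub>v ?a + B *\<^sub>v x) + scalar_prod x (transpose_mat B *\<^sub>v ?a + K *\<^sub>v x)"
      using A B K(1) x by (simp add: scalar_prod_append[of _ 1 _ n])
    also have "scalar_prod ?a (A *\<^sub>v ?a + B *\<^sub>v x) = a * (c * a - scalar_prod f x)"
      by (simp only: Aa Bx) (simp add: scalar_prod_def)
    also have "scalar_prod x (transpose_mat B *\<^sub>v ?a + K *\<^sub>v x) = - a * scalar_prod f x + scalar_prod x (K *\<^sub>v x)"
      unfolding Ca using f x K(1) comm_scalar_prod[OF f x] by (simp add: scalar_prod_add_distrib[of _ n])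
    finally show ?thesis
      by (simp add: power2_eq_square algebra_simps)
  qed
  have split: "\<exists>a x. x \<in> carrier_vec n \<and> y = append_vec (Matrix.vec 1 (\<lambda>_. a)) x"
    if y: "y \<in> carrier_vec (1 + n)" for y :: "real Matrix.vec"
  proof (intro exI conjI)
    have "vec_first y 1 = Matrix.vec 1 (\<lambda>_. vec_index y 0)"
      by (intro eq_vecI) (auto simp: vec_first_def)
    then show "y = append_vec (Matrix.vec 1 (\<lambda>_. vec_index y 0)) (vec_last y n)"
      using vec_first_last_append[OF y] by simp
  qed simp
  have joined: "append_vec (Matrix.vec 1 (\<lambda>_. a)) x \<in> carrier_vec (1 + n)" if "x \<in> carrier_vec n" for a :: real and x
    using that by (intro append_carrier_vec) auto
  have "mat_psd M \<longleftrightarrow> (\<forall>y\<in>carrier_vec (1 + n). 0 \<le> scalar_prod y (M *\<^sub>v y))"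
    using M \<open>transpose_mat M = M\<close> by (auto simp: mat_psd_def)
  also have "\<dots> \<longleftrightarrow> (\<forall>a. \<forall>x\<in>carrier_vec n. 0 \<le> c * a\<^sup>2 - 2 * a * scalar_prod f x + scalar_prod x (K *\<^sub>v x))"
    using form split joined by metis
  finally show ?thesis
    by (simp add: M_def)
qed

text \<open>A kernel vector would violate definiteness, so K is invertible.\<close>

lemma mat_pd_solve:
  assumes K: "K \<in> carrier_mat n n" "mat_pd K" and f: "f \<in> carrier_vec n"
  obtains y where "y \<in> carrier_vec n" "K *\<^sub>v y = f"
proof -
  have "Determinant.det K \<noteq> 0"
  proof
    assume "Determinant.det K = 0"
    then obtain x where x: "x \<in> carrier_vec n" "x \<noteq> 0\<^sub>v n" "K *\<^sub>v x = 0\<^sub>v n"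
      using det_0_iff_vec_prod_zero[OF K(1)] by blast
    then have "0 < scalar_prod x (K *\<^sub>v x)"
      using K unfolding mat_pd_def by auto
    then show False
      using x by simp
  qed
  then have "K \<in> Units (ring_mat TYPE(real) n ())"
    by (rule det_non_zero_imp_unit[OF K(1)])
  then obtain B where B: "B \<in> carrier_mat n n" "K * B = 1\<^sub>m n"
    by (auto simp: Units_def ring_mat_simps)
  have "K *\<^sub>v (B *\<^sub>v f) = (K * B) *\<^sub>v f"
    using K(1) B(1) f by simp
  then have "K *\<^sub>v (B *\<^sub>v f) = f"
    using B(2) f by simp
  then show thesis
    using B(1) f by (intro that[of "B *\<^sub>v f"]) auto
qed

text \<open>The witness is the compliance f . y, where K y = f; with it the quadratic form equals
  that of K at x - a y.\<close>

lemma mat_pd_imp_psd_compliance: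
  assumes K: "K \<in> carrier_mat n n" "mat_pd K" and f: "f \<in> carrier_vec n"
  shows "\<exists>c. mat_psd (compliance_mat c f K)"
proof -
  obtain y where y: "y \<in> carrier_vec n" "K *\<^sub>v y = f"
    using mat_pd_solve[OF assms] .
  have sym: "transpose_mat K = K"
    using K(2) by (simp add: mat_pd_def)
  have "0 \<le> scalar_prod f y * a\<^sup>2 - 2 * a * scalar_prod f x + scalar_prod x (K *\<^sub>v x)"
    if x: "x \<in> carrier_vec n" for a x
  proof -
    \<comment> \<open>completing the square around the solution y of K y = f\<close>
    define z where "z = x - a \<cdot>\<^sub>v y"
    have z: "z \<in> carrier_vec n"
      using x y by (simp add: z_def)
    have "0 \<le> scalar_prod z (K *\<^sub>v z)"
      \<comment> \<open>\<open>mat_pd\<close> speaks of nonzero vectors only, so z = 0 is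
        separated.\<close>
      using K z by (cases "z = 0\<^sub>v n") (auto simp: mat_pd_def intro: less_imp_le)
    also have "K *\<^sub>v z = K *\<^sub>v x - a \<cdot>\<^sub>v f"
      using K(1) x y by (simp add: z_def mult_minus_distrib_mat_vec mult_mat_vec)
    also have "scalar_prod z (K *\<^sub>v x - a \<cdot>\<^sub>v f) =
        scalar_prod x (K *\<^sub>v x) - a * scalar_prod x f - a * (scalar_prod y (K *\<^sub>v x) - a * scalar_prod y f)"
      using K(1) x y(1) f
      by (simp add: z_def minus_scalar_prod_distrib[of _ n] scalar_prod_minus_distrib[of _ n] right_diff_distrib)
    also have "scalar_prod y (K *\<^sub>v x) = scalar_prod f x"
      using transpose_vec_mult_scalar[OF K(1) x y(1)] y(2) sym by simp
    finally show ?thesis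
      using comm_scalar_prod[OF x f] comm_scalar_prod[OF y(1) f]
      by (simp add: power2_eq_square algebra_simps)
  qed
  then show ?thesis
    using mat_psd_compliance_iff[OF f K(1) sym] by blast
qed

section \<open>Existence of a minimiser\<close>

text \<open>The Weierstrass theorem is applied to a sublevel set of the objective, transported to
  Euclidean vectors, where closed and bounded sets are compact.\<close>

lemma hs_minimizer_exists:
  fixes \<kappa>m \<kappa>p \<mu>m \<mu>p V :: real
    and n :: "'l::finite \<Rightarrow> nat"
    and f :: "'l \<Rightarrow> real Matrix.vec"
    and K :: "'l \<Rightarrow> ('e::finite \<Rightarrow> tensor4) \<Rightarrow> real mat"
  assumes pos: "0 < \<kappa>m" "\<kappa>m < \<kappa>p" "0 < \<mu>m" "\<mu>m < \<mu>p"
    and V: "0 \<le> V"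
    and f_dim: "\<And>j. f j \<in> carrier_vec (n j)"
    and K_dim: "\<And>j E. (\<And>i. E i \<in> sym4) \<Longrightarrow> K j E \<in> carrier_mat (n j) (n j)"
    and K_sym: "\<And>j E. (\<And>i. E i \<in> sym4) \<Longrightarrow> transpose_mat (K j E) = K j E"
    and K_add: "\<And>j E F. (\<And>i. E i \<in> sym4) \<Longrightarrow> (\<And>i. F i \<in> sym4) \<Longrightarrow>
                  K j (\<lambda>i. E i + F i) = K j E + K j F"
    and K_scale: "\<And>j a E. (\<And>i. E i \<in> sym4) \<Longrightarrow>
                  K j (\<lambda>i. a *\<^sub>R E i) = a \<cdot>\<^sub>m K j E"
    and K_pd: "\<And>j E. (\<And>i. E i \<in> sym4) \<Longrightarrow> (\<And>i. loewner_less 0 (E i)) \<Longrightarrow> mat_pd (K j E)"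
  shows "\<exists>x. is_arg_min (\<lambda>(c, E, v). \<Sum>j\<in>UNIV. c j)
           (\<lambda>x. x \<in> hs_feasible \<kappa>m \<kappa>p \<mu>m \<mu>p f K V) x"
proof -
  let ?F = "hs_feasible \<kappa>m \<kappa>p \<mu>m \<mu>p f K V"
  have "\<exists>c. mat_psd (compliance_mat c (f j) (K j (\<lambda>_. iso_tensor \<kappa>m \<mu>m)))" for j
    using iso_tensor_pos[of \<kappa>m \<mu>m] pos
    by (intro mat_pd_imp_psd_compliance[OF K_dim K_pd f_dim]) (auto simp: iso_tensor_sym4)
  then obtain c0 where c0: "\<And>j. mat_psd (compliance_mat (c0 j) (f j) (K j (\<lambda>_. iso_tensor \<kappa>m \<mu>m)))"
    by metis
  have vec_nth_lambda: "($) (vec_lambda h) = h" for h :: "'i::finite \<Rightarrow> 'a"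
    by (rule ext) simp
  have x0: "(c0, \<lambda>_. iso_tensor \<kappa>m \<mu>m, \<lambda>_. 0) \<in> ?F"
    using c0 iso_tensor_mem_A2[OF pos] V by (simp add: hs_feasible_def)
  \<comment> \<open>The level is the objective value of the weak-phase point, so that
    \<open>X\<close> is nonempty.\<close>
  define s0 where "s0 = (\<Sum>j\<in>UNIV. c0 j)"
  define X :: "((real^'l) \<times> (tensor4^'e) \<times> (real^'e)) set" where
    "X = {x. (($) (fst x), ($) (fst (snd x)), ($) (snd (snd x))) \<in> ?F \<and> (\<Sum>j\<in>UNIV. fst x $ j) \<le> s0}"

  define W where "W j y E = scalar_prod y (K j (\<lambda>i. sym4_proj (E $ i)) *\<^sub>v y)" for j y and E :: "tensor4^'e"
  have cont_W: "continuous_on UNIV (W j y)" if y: "y \<in> carrier_vec (n j)" for j y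
  proof -
    have Kc: "K j (\<lambda>i. sym4_proj (E $ i)) \<in> carrier_mat (n j) (n j)" for E :: "tensor4^'e"
      by (intro K_dim sym4_proj_mem)
    have "linear (W j y)"
    proof (rule linearI)
      fix E F :: "tensor4^'e" and r :: real
      have "K j (\<lambda>i. sym4_proj ((E + F) $ i)) = K j (\<lambda>i. sym4_proj (E $ i)) + K j (\<lambda>i. sym4_proj (F $ i))"
        by (simp add: sym4_proj_linear K_add sym4_proj_mem)
      then show "W j y (E + F) = W j y E + W j y F"
        unfolding W_def using Kc[of E] Kc[of F] y
        by (simp add: add_mult_distrib_mat_vec[OF Kc Kc y] scalar_prod_add_distrib[of _ "n j"])
      have "K j (\<lambda>i. sym4_proj ((r *\<^sub>R E) $ i)) = r \<cdot>\<^sub>m K j (\<lambda>i. sym4_proj (E $ i))"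
        by (simp add: sym4_proj_linear K_scale sym4_proj_mem)
      moreover have "(r \<cdot>\<^sub>m M) *\<^sub>v y = r \<cdot>\<^sub>v (M *\<^sub>v y)" if "M \<in> carrier_mat (n j) (n j)" for M
        using that y by (intro eq_vecI) auto
      ultimately show "W j y (r *\<^sub>R E) = r *\<^sub>R W j y E"
        unfolding W_def using Kc[of E] y by simp
    qed
    then show ?thesis
      by (simp add: linear_continuous_on linear_conv_bounded_linear)
  qed
  \<comment> \<open>clipping the volume fraction makes the bound continuous on the whole line\<close>
  define g where "g \<epsilon> u = f_HS \<kappa>m \<kappa>p \<mu>m \<mu>p \<epsilon> (max 0 (min 1 u))" for \<epsilon> u
  have cont_g: "continuous_on UNIV (g \<epsilon>)" if "\<epsilon> \<in> sym2" for \<epsilon>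
    unfolding g_def
    by (intro continuous_on_compose2[OF f_HS_continuous_mono_on(1)[OF pos that]] continuous_intros) auto
  have lin_proj: "linear sym4_proj" and lin_app: "linear (\<lambda>E. tensor_app E \<epsilon>)" for \<epsilon>
    by (auto intro!: linearI simp: sym4_proj_linear tensor_app_linear)
  have cont_proj: "continuous_on UNIV sym4_proj"
    and cont_app: "continuous_on UNIV (\<lambda>E. tensor_app E \<epsilon>)" for \<epsilon>
    using lin_proj lin_app by (simp_all add: linear_continuous_on linear_conv_bounded_linear)

  \<comment> \<open>An intersection of conditions, one for each test vector or strain, that are
    visibly closed.\<close>
  have X_eq: "X = {x. (\<forall>j a. \<forall>y\<in>carrier_vec (n j).
          0 \<le> fst x $ j * a\<^sup>2 - 2 * a * scalar_prod (f j) y + W j y (fst (snd x)))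
      \<and> (\<forall>i. sym4_proj (fst (snd x) $ i) = fst (snd x) $ i)
      \<and> (\<forall>i. \<forall>\<epsilon>\<in>sym2. 0 \<le> tensor_app (fst (snd x) $ i - iso_tensor \<kappa>m \<mu>m) \<epsilon> \<bullet> \<epsilon>)
      \<and> (\<forall>i. \<forall>\<epsilon>\<in>sym2. tensor_app (fst (snd x) $ i) \<epsilon> \<bullet> \<epsilon> \<le> g \<epsilon> (snd (snd x) $ i))
      \<and> (\<Sum>i\<in>UNIV. snd (snd x) $ i) / real CARD('e) \<le> V
      \<and> (\<forall>i. 0 \<le> snd (snd x) $ i \<and> snd (snd x) $ i \<le> 1)
      \<and> (\<Sum>j\<in>UNIV. fst x $ j) \<le> s0}" (is "_ = ?Y")
  proof -
    have "x \<in> X \<longleftrightarrow> x \<in> ?Y" for x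
    proof -
      obtain c E v where x: "x = (c, E, v)" by (cases x)
      \<comment> \<open>For symmetric tensors and volume fractions in [0,1] projection and clipping
        do nothing; otherwise both descriptions fail.\<close>
      show ?thesis
      proof (cases "(\<forall>i. E $ i \<in> sym4) \<and> (\<forall>i. 0 \<le> v $ i \<and> v $ i \<le> 1)")
        case True
        then have E: "\<And>i. E $ i \<in> sym4" "\<And>i. sym4_proj (E $ i) = E $ i"
          by (auto simp: sym4_proj_eq_iff)
        have psd: "mat_psd (compliance_mat (c $ j) (f j) (K j (($) E))) \<longleftrightarrow>
            (\<forall>a. \<forall>y\<in>carrier_vec (n j). 0 \<le> c $ j * a\<^sup>2 - 2 * a * scalar_prod (f j) y + W j y E)" for j
          unfolding W_def E(2) by (intro mat_psd_compliance_iff f_dim K_dim K_sym E(1))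
        have "g \<epsilon> (v $ i) = f_HS \<kappa>m \<kappa>p \<mu>m \<mu>p \<epsilon> (v $ i)" for \<epsilon> i
          using True by (simp add: g_def)
        then have A2: "E $ i \<in> A2 \<kappa>m \<kappa>p \<mu>m \<mu>p (v $ i) \<longleftrightarrow>
            (\<forall>\<epsilon>\<in>sym2. 0 \<le> tensor_app (E $ i - iso_tensor \<kappa>m \<mu>m) \<epsilon> \<bullet> \<epsilon>) \<and>
            (\<forall>\<epsilon>\<in>sym2. tensor_app (E $ i) \<epsilon> \<bullet> \<epsilon> \<le> g \<epsilon> (v $ i))" for i
          using E(1) by (simp add: A2_def loewner_le_def)
        show ?thesis
          unfolding x X_def mem_Collect_eq fst_conv snd_conv hs_feasible_def prod.case psd A2 E(2)
          by blast
      next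
        case False
        then show ?thesis
          unfolding x X_def mem_Collect_eq fst_conv snd_conv hs_feasible_def prod.case A2_def sym4_proj_eq_iff
          by blast
      qed
    qed
    then show ?thesis by blast
  qed
  have closed_ball: "closed {x. \<forall>y\<in>S. P x y}" if "\<And>y. y \<in> S \<Longrightarrow> closed {x. P x y}"
    for S :: "'b set" and P :: "(real^'l) \<times> (tensor4^'e) \<times> (real^'e) \<Rightarrow> 'b \<Rightarrow> bool"
    using that by (simp add: Collect_ball_eq closed_INT)
  have closed1: "closed {x. 0 \<le> fst x $ j * a\<^sup>2 - 2 * a * scalar_prod (f j) y + W j y (fst (snd x))}"
    if "y \<in> carrier_vec (n j)" for j a y
    by (intro closed_Collect_le continuous_intros continuous_on_compose2[OF cont_W[OF that]]) auto
  have closed2: "closed {x. sym4_proj (fst (snd x) $ i) = fst (snd x) $ i}" for i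
    by (intro closed_Collect_eq continuous_intros continuous_on_compose2[OF cont_proj]) auto
  have closed3: "closed {x. 0 \<le> tensor_app (fst (snd x) $ i - iso_tensor \<kappa>m \<mu>m) \<epsilon> \<bullet> \<epsilon>}" for i \<epsilon>
    by (intro closed_Collect_le continuous_intros continuous_on_compose2[OF cont_app]) auto
  have closed4: "closed {x. tensor_app (fst (snd x) $ i) \<epsilon> \<bullet> \<epsilon> \<le> g \<epsilon> (snd (snd x) $ i)}"
    if "\<epsilon> \<in> sym2" for i \<epsilon>
    by (intro closed_Collect_le continuous_intros continuous_on_compose2[OF cont_app]
        continuous_on_compose2[OF cont_g[OF that]]) auto
  have "closed X"
    unfolding X_eq
    by (intro closed_Collect_conj closed_Collect_all closed_ball closed1 closed2 closed3 closed4)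
      (assumption | intro closed_Collect_le continuous_intros | simp)+
  moreover have "bounded X"
  proof -
    obtain C where C: "\<And>v E. v \<in> {0..1} \<Longrightarrow> E \<in> A2 \<kappa>m \<kappa>p \<mu>m \<mu>p v \<Longrightarrow> norm E \<le> C"
      using A2_bounded[OF pos] by blast
    \<comment> \<open>The c are nonnegative with sum at most \<open>s0\<close>, which bounds each of
      them; E and v are bounded entrywise.\<close>
    have "X \<subseteq> cball 0 s0 \<times> cball 0 (real CARD('e) * C) \<times> cball 0 (real CARD('e))"
    proof
      fix x assume xX: "x \<in> X"
      obtain c E v where x: "x = (c, E, v)" by (cases x)
      have feas: "(($) c, ($) E, ($) v) \<in> ?F" and s: "(\<Sum>j\<in>UNIV. c $ j) \<le> s0"
        using xX by (auto simp: X_def x)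
      have v: "v $ i \<in> {0..1}" and E: "E $ i \<in> A2 \<kappa>m \<kappa>p \<mu>m \<mu>p (v $ i)" for i
        using feas by (auto simp: hs_feasible_def)
      have "0 \<le> c $ j" for j
      proof -
        have "\<forall>a. \<forall>y\<in>carrier_vec (n j). 0 \<le> c $ j * a\<^sup>2 - 2 * a * scalar_prod (f j) y + W j y E"
          using xX unfolding X_eq by (simp add: x)
        \<comment> \<open>Testing with a = 1 and the zero vector isolates the corner entry
          c.\<close>
        from this[rule_format, of "0\<^sub>v (n j)" 1] have "0 \<le> c $ j - 2 * scalar_prod (f j) (0\<^sub>v (n j)) + W j (0\<^sub>v (n j)) E"
          by simp
        moreover have "W j (0\<^sub>v (n j)) E = 0"
          unfolding W_def using K_dim[of "\<lambda>i. sym4_proj (E $ i)" j] sym4_proj_mem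
          by (intro scalar_prod_left_zero mult_mat_vec_carrier) auto
        ultimately show ?thesis
          using scalar_prod_right_zero[OF f_dim] by simp
      qed
      then have "norm c \<le> s0"
        using norm_vec_le_sum[of c] s by simp
      moreover have "norm E \<le> real CARD('e) * C"
        using norm_vec_le_sum[of E] sum_bounded_above[of UNIV "\<lambda>i. norm (E $ i)" C] C[OF v E] by simp
      moreover have "norm v \<le> real CARD('e)"
        using norm_vec_le_sum[of v] sum_bounded_above[of UNIV "\<lambda>i. norm (v $ i)" 1] v by simp
      ultimately show "x \<in> cball 0 s0 \<times> cball 0 (real CARD('e) * C) \<times> cball 0 (real CARD('e))"
        by (simp add: x)
    qed
    then show ?thesis
      by (rule bounded_subset[rotated]) (intro bounded_Times bounded_cball)
  qed
  ultimately have "compact X"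
    by (simp add: compact_eq_bounded_closed)
  moreover have "(\<chi> j. c0 j, \<chi> i. iso_tensor \<kappa>m \<mu>m, \<chi> i. 0) \<in> X"
    using x0 by (simp add: X_def s0_def vec_nth_lambda)
  moreover have cont_obj: "continuous_on X (\<lambda>x. \<Sum>j\<in>UNIV. fst x $ j)"
    by (intro continuous_intros)
  ultimately obtain x where x: "x \<in> X" "\<And>y. y \<in> X \<Longrightarrow> (\<Sum>j\<in>UNIV. fst x $ j) \<le> (\<Sum>j\<in>UNIV. fst y $ j)"
    using continuous_attains_inf[OF _ _ cont_obj] by blast
  obtain c E v where xe: "x = (c, E, v)" by (cases x)
  \<comment> \<open>A feasible point outside \<open>X\<close> has objective above \<open>s0\<close>,
    so it cannot beat the minimiser over \<open>X\<close>.\<close>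
  have "(\<Sum>j\<in>UNIV. c $ j) \<le> (\<Sum>j\<in>UNIV. c' j)" if "(c', E', v') \<in> ?F" for c' E' v'
  proof (cases "(\<Sum>j\<in>UNIV. c' j) \<le> s0")
    case True
    then have "(\<chi> j. c' j, \<chi> i. E' i, \<chi> i. v' i) \<in> X"
      using that by (simp add: X_def vec_nth_lambda)
    from x(2)[OF this] show ?thesis
      by (simp add: xe)
  next
    case False
    then show ?thesis
      using x(1) by (simp add: X_def xe)
  qed
  moreover have "(($) c, ($) E, ($) v) \<in> ?F"
    using x(1) by (simp add: X_def xe)
  ultimately show ?thesis
    by (intro exI[of _ "(($) c, ($) E, ($) v)"]) (fastforce simp: is_arg_min_def not_less)
qed

section \<open>Lowering the volume fractions of a minimiser\<close>

theorem lemma3p3: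
  fixes \<kappa>m \<kappa>p \<mu>m \<mu>p V :: real
    and n :: "'l::finite \<Rightarrow> nat"
    and f :: "'l \<Rightarrow> real Matrix.vec"
    and K :: "'l \<Rightarrow> ('e::finite \<Rightarrow> tensor4) \<Rightarrow> real mat"
  assumes kappa: "0 < \<kappa>m" "\<kappa>m < \<kappa>p"
    and mu: "0 < \<mu>m" "\<mu>m < \<mu>p"
    and V: "0 \<le> V" "V \<le> 1"
    and f_dim: "\<And>j. f j \<in> carrier_vec (n j)"
    and K_dim: "\<And>j E. (\<And>i. E i \<in> sym4) \<Longrightarrow> K j E \<in> carrier_mat (n j) (n j)"
    and K_sym: "\<And>j E. (\<And>i. E i \<in> sym4) \<Longrightarrow> transpose_mat (K j E) = K j E"
    and K_add: "\<And>j E F. (\<And>i. E i \<in> sym4) \<Longrightarrow> (\<And>i. F i \<in> sym4) \<Longrightarrow>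
                  K j (\<lambda>i. E i + F i) = K j E + K j F"
    and K_scale: "\<And>j a E. (\<And>i. E i \<in> sym4) \<Longrightarrow>
                  K j (\<lambda>i. a *\<^sub>R E i) = a \<cdot>\<^sub>m K j E"
    and K_psd: "\<And>j E. (\<And>i. E i \<in> sym4) \<Longrightarrow> (\<And>i. loewner_le 0 (E i)) \<Longrightarrow> mat_psd (K j E)"
    and K_pd: "\<And>j E. (\<And>i. E i \<in> sym4) \<Longrightarrow> (\<And>i. loewner_less 0 (E i)) \<Longrightarrow> mat_pd (K j E)"
  shows "\<exists>c E v.
      is_arg_min (\<lambda>(c, E, v). \<Sum>j\<in>UNIV. c j)
        (\<lambda>x. x \<in> hs_feasible \<kappa>m \<kappa>p \<mu>m \<mu>p f K V) (c, E, v)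
      \<and> (\<forall>i. v i = v_bar \<kappa>m \<kappa>p \<mu>m \<mu>p (E i)
           \<and> v_bar \<kappa>m \<kappa>p \<mu>m \<mu>p (E i) = Inf {u \<in> {0..1}. E i \<in> A2 \<kappa>m \<kappa>p \<mu>m \<mu>p u})"
proof -
  note pos = kappa mu
  let ?F = "hs_feasible \<kappa>m \<kappa>p \<mu>m \<mu>p f K V"
  have "\<exists>x. is_arg_min (\<lambda>(c, E, v). \<Sum>j\<in>UNIV. c j) (\<lambda>x. x \<in> ?F) x"
    by (rule hs_minimizer_exists[OF pos V(1), where n = n]) (fact assms)+
  then obtain c E v where opt: "is_arg_min (\<lambda>(c, E, v). \<Sum>j\<in>UNIV. c j) (\<lambda>x. x \<in> ?F) (c, E, v)"
    by (metis prod_cases3)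
  then have feas: "(c, E, v) \<in> ?F"
    by (simp add: is_arg_min_def)
  then have v: "v i \<in> {0..1}" and E: "E i \<in> A2 \<kappa>m \<kappa>p \<mu>m \<mu>p (v i)" for i
    by (auto simp: hs_feasible_def)
  define u where "u i = v_bar \<kappa>m \<kappa>p \<mu>m \<mu>p (E i)" for i
  have u: "u i \<in> {0..1}" "E i \<in> A2 \<kappa>m \<kappa>p \<mu>m \<mu>p (u i)" "u i \<le> v i" for i
    unfolding u_def by (rule v_bar_least[OF pos v E])+
  have "(\<Sum>i\<in>UNIV. u i) / real CARD('e) \<le> (\<Sum>i\<in>UNIV. v i) / real CARD('e)"
    by (intro divide_right_mono sum_mono u(3)) simp
  also have "\<dots> \<le> V"
    using feas by (simp add: hs_feasible_def)
  finally have "(c, E, u) \<in> ?F"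
    using feas u(1,2) by (simp add: hs_feasible_def)
  \<comment> \<open>The new point has the same c, hence the same objective value.\<close>
  then have "is_arg_min (\<lambda>(c, E, v). \<Sum>j\<in>UNIV. c j) (\<lambda>x. x \<in> ?F) (c, E, u)"
    using opt by (simp add: is_arg_min_def)
  moreover have "v_bar \<kappa>m \<kappa>p \<mu>m \<mu>p (E i) = Inf {u \<in> {0..1}. E i \<in> A2 \<kappa>m \<kappa>p \<mu>m \<mu>p u}" for i
    by (rule v_bar_eq_Inf[OF pos v E])
  ultimately show ?thesis
    unfolding u_def by blast
qed

end
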